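(* Let $q\ge 1$, let $f:\mathbb{R}^n\to\mathbb{R}^n$ be a $C^q$ function, and let $\mathbf{F}=(F_1,\dots,F_k):\mathbb{R}^n\to\mathbb{R}^k$, $k\le n$, be a $C^q$ vectorial conserved quantity of the differential equation $\dot x=f(x)$. For $s\in\{0,\dots,k\}$ let $$M^F_{(s)}=\{x\in\mathbb{R}^n \mid \operatorname{rank}\nabla\mathbf{F}(x)=s\}.$$ Then, for every $s\in\{0,\dots,k\}$, the set $M^F_{(s)}$ is invariant under the dynamics generated by $\dot x=f(x)$.
   Context: $\nabla\mathbf{F}(x)$ denotes the $k\times n$ Jacobian matrix $\left(\frac{\partial F_i}{\partial x_j}(x)\right)_{1\le i\le k,\,1\le j\le n}$. Let $\Phi_t$ denote the flow of $\dot x=f(x)$, i.e. $t\mapsto\Phi_t(x)$ is the solution with $\Phi_0(x)=x$. $\mathbf{F}$ is a (vectorial) conserved quantity if $\mathbf{F}(\Phi_t(x))=\mathbf{F}(x)$ for all $x$ and all $t$ for which $\Phi_t(x)$ is defined. A set $M\subseteq\mathbb{R}^n$ is invariant under the dynamics if $x\in M$ implies $\Phi_t(x)\in M$ for all $t$ for which $\Phi_t(x)$ is defined. *)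

theory Defs
  imports "HOL-Analysis.Analysis"
begin

text \<open>Since the domain is finite-dimensional, continuity of \<open>x \<mapsto> Df(x) v\<close> for every
  direction \<open>v\<close> is the same as continuity of \<open>x \<mapsto> Df(x)\<close> in operator norm, and likewise for
  the higher derivatives; so the recursion below is the usual class \<open>C\<^sup>q\<close> of maps on the whole
  space.\<close>

primrec C_diff :: "nat \<Rightarrow> ('a::euclidean_space \<Rightarrow> 'b::euclidean_space) \<Rightarrow> bool" where
  "C_diff 0 g \<longleftrightarrow> continuous_on UNIV g"
| "C_diff (Suc q) g \<longleftrightarrow>
     (\<forall>x. g differentiable (at x)) \<and> (\<forall>v. C_diff q (\<lambda>x. frechet_derivative g (at x) v))"

definition is_solution ::
  "('a::euclidean_space \<Rightarrow> 'a) \<Rightarrow> 'a \<Rightarrow> real set \<Rightarrow> (real \<Rightarrow> 'a) \<Rightarrow> bool" where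
  "is_solution f x J u \<longleftrightarrow>
     open J \<and> is_interval J \<and> 0 \<in> J \<and> u 0 = x \<and>
     (\<forall>t\<in>J. (u has_vector_derivative f (u t)) (at t))"

text \<open>The set of times at which the (local) flow through \<open>x\<close> is defined, i.e. the maximal
  interval of existence.\<close>

definition flow_dom :: "('a::euclidean_space \<Rightarrow> 'a) \<Rightarrow> 'a \<Rightarrow> real set" where
  "flow_dom f x = \<Union>{J. \<exists>u. is_solution f x J u}"

text \<open>\<open>flow f t x\<close> is \<open>\<Phi>\<^sub>t(x)\<close>. The description is meaningful only for \<open>t \<in> flow_dom f x\<close> and
  when solutions of initial value problems are unique, which holds for \<open>f\<close> of class \<open>C\<^sup>1\<close>.\<close>

definition flow :: "('a::euclidean_space \<Rightarrow> 'a) \<Rightarrow> real \<Rightarrow> 'a \<Rightarrow> 'a" where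
  "flow f t x = (THE y. \<exists>J u. is_solution f x J u \<and> t \<in> J \<and> u t = y)"

definition conserved_quantity ::
  "('a::euclidean_space \<Rightarrow> 'a) \<Rightarrow> ('a \<Rightarrow> 'b) \<Rightarrow> bool" where
  "conserved_quantity f F \<longleftrightarrow> (\<forall>x. \<forall>t\<in>flow_dom f x. F (flow f t x) = F x)"

definition invariant_set :: "('a::euclidean_space \<Rightarrow> 'a) \<Rightarrow> 'a set \<Rightarrow> bool" where
  "invariant_set f M \<longleftrightarrow> (\<forall>x\<in>M. \<forall>t\<in>flow_dom f x. flow f t x \<in> M)"

definition rank_set :: "(real^'n \<Rightarrow> real^'k) \<Rightarrow> nat \<Rightarrow> (real^'n) set" where
  "rank_set F s = {x. rank (jacobian F (at x)) = s}"

end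

theory Submission
  imports Defs
begin

text \<open>
  If the flow were known to be a diffeomorphism, differentiating \<open>F (\<Phi>\<^sub>t x) = F x\<close> would give
  \<open>DF (\<Phi>\<^sub>t x) \<circ> D\<Phi>\<^sub>t x = DF x\<close> with \<open>D\<Phi>\<^sub>t x\<close> invertible, and the ranks would agree. The proof below
  replaces differentiability of \<open>\<Phi>\<^sub>t\<close> by a Lipschitz bound, in two observations.

  The rank of \<open>DF x\<close> is determined by its left kernel, the set of those \<open>w\<close> for which \<open>x\<close> is a
  critical point of the scalar conserved quantity \<open>G = w \<bullet> F\<close>. So it suffices that a solution
  which meets a critical point of \<open>G\<close> consists of critical points of \<open>G\<close>
  (\<open>critical_point_carried\<close>).

  Let \<open>p\<close> be a critical point of \<open>G\<close> on a solution, and \<open>p'\<close> a nearby point of the same solution. A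
  point \<open>y\<close> close to \<open>p'\<close> is joined by a solution to a point \<open>y\<^sub>0\<close> with \<open>|y\<^sub>0 - p| \<le> C |y - p'|\<close>. Since
  \<open>G\<close> is conserved, \<open>G y - G p' = G y\<^sub>0 - G p = o(|y\<^sub>0 - p|) = o(|y - p'|)\<close>, so \<open>p'\<close> is critical as
  well (\<open>critical_point_carried_locally\<close>). The times at which the solution is at a critical point
  therefore form an open set; it is closed because \<open>DG\<close> is continuous, and the time interval is
  connected.

  The ingredients from the theory of differential equations are a time of existence that is uniform
  for initial values near \<open>p\<close> (\<open>local_existence\<close>, by Picard iteration) and the exponential bound
  on the distance of two solutions
  (\<open>solutions_diverge_at_most_exponentially\<close>, by Gronwall's argument), which also gives the uniqueness
  that makes \<open>flow\<close> well defined.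
\<close>

section \<open>Maps of class C1\<close>

lemma C_diff_imp_continuous: "C_diff q g \<Longrightarrow> continuous_on UNIV g"
  by (cases q) (auto simp: continuous_on_eq_continuous_at dest: differentiable_imp_continuous_within)

lemma C_diff_imp_differentiable: "C_diff q g \<Longrightarrow> q \<ge> 1 \<Longrightarrow> g differentiable (at x)"
  by (cases q) auto

lemma C_diff_imp_continuous_derivative:
  "C_diff q g \<Longrightarrow> q \<ge> 1 \<Longrightarrow> continuous_on UNIV (\<lambda>x. frechet_derivative g (at x) v)"
  by (cases q) (auto intro: C_diff_imp_continuous)

text \<open>Continuity of \<open>x \<mapsto> Dg x b\<close> for the finitely many basis vectors \<open>b\<close> bounds the operator norm
  of \<open>Dg\<close> on a compact ball, and the ball is convex.\<close>

lemma C_diff_imp_locally_lipschitz: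
  fixes g :: "'a::euclidean_space \<Rightarrow> 'b::euclidean_space"
  assumes "C_diff q g" "q \<ge> 1"
  obtains L where "L-lipschitz_on (cball p r) g"
proof -
  let ?D = "\<lambda>x. frechet_derivative g (at x)"
  have "\<exists>K. \<forall>x\<in>cball p r. norm (?D x b) \<le> K" for b
  proof -
    have "compact ((\<lambda>x. ?D x b) ` cball p r)"
      by (intro compact_continuous_image continuous_on_subset[OF C_diff_imp_continuous_derivative[OF assms]])
         auto
    then show ?thesis
      by (auto dest!: compact_imp_bounded simp: bounded_iff)
  qed
  then obtain K where K: "\<And>b x. x \<in> cball p r \<Longrightarrow> norm (?D x b) \<le> K b"
    by metis
  let ?L = "\<Sum>b\<in>Basis. \<bar>K b\<bar>"
  have der: "(g has_derivative ?D x) (at x)" for x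
    using C_diff_imp_differentiable[OF assms] by (simp add: frechet_derivative_works)
  have on: "onorm (?D x) \<le> ?L" if x: "x \<in> cball p r" for x
  proof (rule onorm_bound)
    fix v
    have lin: "linear (?D x)"
      using der has_derivative_linear by blast
    have "?D x v = (\<Sum>b\<in>Basis. (v \<bullet> b) *\<^sub>R ?D x b)"
      by (subst euclidean_representation[symmetric, of v])
         (simp only: linear_sum[OF lin] linear_cmul[OF lin])
    also have "norm \<dots> \<le> (\<Sum>b\<in>Basis. \<bar>K b\<bar> * norm v)"
    proof (rule sum_norm_le)
      fix b :: 'a assume b: "b \<in> Basis"
      have "norm ((v \<bullet> b) *\<^sub>R ?D x b) = \<bar>v \<bullet> b\<bar> * norm (?D x b)" by simp
      also have "\<dots> \<le> norm v * \<bar>K b\<bar>"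
        using K[OF x, of b] Basis_le_norm[OF b, of v] by (intro mult_mono) auto
      finally show "norm ((v \<bullet> b) *\<^sub>R ?D x b) \<le> \<bar>K b\<bar> * norm v" by (simp add: mult.commute)
    qed
    finally show "norm (?D x v) \<le> ?L * norm v" by (simp add: sum_distrib_right)
  qed (auto intro: sum_nonneg)
  have "?L-lipschitz_on (cball p r) g"
    using on by (intro bounded_derivative_imp_lipschitz[where f' = ?D] has_derivative_at_withinI[OF der])
      (auto intro: sum_nonneg)
  then show thesis by (rule that)
qed

section \<open>Gronwall's estimate\<close>

text \<open>The hypothesis makes \<open>|z|\<^sup>2 exp (- 2 L t)\<close> nonincreasing; the square is used because the norm
  itself is not differentiable at zeros of \<open>z\<close>.\<close>

lemma gronwall_forward:
  fixes z :: "real \<Rightarrow> 'a::real_inner"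
  assumes "a \<le> b"
    and der: "\<And>t. t \<in> {a..b} \<Longrightarrow> (z has_vector_derivative z' t) (at t)"
    and le: "\<And>t. t \<in> {a..b} \<Longrightarrow> norm (z' t) \<le> L * norm (z t)"
  shows "norm (z b) \<le> exp (L * (b - a)) * norm (z a)"
proof -
  define \<phi> where "\<phi> t = exp (- 2 * L * (t - a)) * (z t \<bullet> z t)" for t
  have "\<phi> a \<ge> \<phi> b"
  proof (rule DERIV_nonpos_imp_nonincreasing[OF \<open>a \<le> b\<close>])
    fix t assume "a \<le> t" "t \<le> b"
    then have t: "t \<in> {a..b}" by simp
    have "((\<lambda>t. z t \<bullet> z t) has_real_derivative 2 * (z t \<bullet> z' t)) (at t)"
      using has_derivative_inner[OF der[OF t, unfolded has_vector_derivative_def]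
          der[OF t, unfolded has_vector_derivative_def]]
      unfolding has_field_derivative_def
      by (rule has_derivative_eq_rhs) (auto simp: fun_eq_iff inner_commute algebra_simps)
    then have "(\<phi> has_real_derivative
        exp (- 2 * L * (t - a)) * (2 * (z t \<bullet> z' t)) - 2 * L * exp (- 2 * L * (t - a)) * (z t \<bullet> z t)) (at t)"
      unfolding \<phi>_def by (auto intro!: derivative_eq_intros simp: algebra_simps)
    moreover have "z t \<bullet> z' t \<le> L * (z t \<bullet> z t)"
    proof -
      have "z t \<bullet> z' t \<le> norm (z t) * norm (z' t)" by (rule norm_cauchy_schwarz)
      also have "\<dots> \<le> norm (z t) * (L * norm (z t))" by (intro mult_left_mono le t) auto
      finally show ?thesis by (simp add: power2_norm_eq_inner[symmetric] power2_eq_square algebra_simps)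
    qed
    then have "exp (- 2 * L * (t - a)) * (2 * (z t \<bullet> z' t))
        \<le> exp (- 2 * L * (t - a)) * (2 * (L * (z t \<bullet> z t)))"
      by (intro mult_left_mono) auto
    then have "exp (- 2 * L * (t - a)) * (2 * (z t \<bullet> z' t))
        - 2 * L * exp (- 2 * L * (t - a)) * (z t \<bullet> z t) \<le> 0"
      by (simp add: algebra_simps)
    ultimately show "\<exists>y. DERIV \<phi> t :> y \<and> y \<le> 0" by blast
  qed
  then have "exp (- 2 * L * (b - a)) * (norm (z b))\<^sup>2 \<le> (norm (z a))\<^sup>2"
    by (simp add: \<phi>_def power2_norm_eq_inner)
  then have "exp (2 * L * (b - a)) * (exp (- 2 * L * (b - a)) * (norm (z b))\<^sup>2)
      \<le> exp (2 * L * (b - a)) * (norm (z a))\<^sup>2"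
    by (intro mult_left_mono) auto
  then have "(norm (z b))\<^sup>2 \<le> exp (2 * L * (b - a)) * (norm (z a))\<^sup>2"
    by (simp add: mult.assoc[symmetric] exp_add[symmetric])
  also have "\<dots> = (exp (L * (b - a)) * norm (z a))\<^sup>2"
    by (simp add: power_mult_distrib power2_eq_square[of "exp _"] exp_add[symmetric])
  finally show ?thesis by (rule power2_le_imp_le) simp
qed

text \<open>The same bound for both directions of time, the backward one by time reversal. Flow times have
  either sign, and transporting a critical point to a later time follows nearby solutions back.\<close>

lemma gronwall:
  fixes z :: "real \<Rightarrow> 'a::real_inner"
  assumes der: "\<And>t. t \<in> closed_segment a b \<Longrightarrow> (z has_vector_derivative z' t) (at t)"
    and le: "\<And>t. t \<in> closed_segment a b \<Longrightarrow> norm (z' t) \<le> L * norm (z t)"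
  shows "norm (z b) \<le> exp (L * \<bar>b - a\<bar>) * norm (z a)"
proof (cases "a \<le> b")
  case True
  then show ?thesis
    using gronwall_forward[of a b z z' L] assms by (auto simp: closed_segment_eq_real_ivl)
next
  case False
  have "norm ((z \<circ> uminus) (- b)) \<le> exp (L * (- b - (- a))) * norm ((z \<circ> uminus) (- a))"
  proof (rule gronwall_forward)
    fix t assume "t \<in> {- a..- b}"
    then have t: "- t \<in> closed_segment a b"
      using False by (auto simp: closed_segment_eq_real_ivl)
    have "(uminus has_vector_derivative (- 1)) (at t)"
      by (auto intro!: derivative_eq_intros)
    from vector_diff_chain_at[OF this der[OF t]]
    show "((z \<circ> uminus) has_vector_derivative - z' (- t)) (at t)" by simp
    show "norm (- z' (- t)) \<le> L * norm ((z \<circ> uminus) t)"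
      using le[OF t] by simp
  qed (use False in auto)
  then show ?thesis using False by simp
qed

lemma solutions_diverge_at_most_exponentially:
  fixes f :: "'a::real_inner \<Rightarrow> 'a"
  assumes lip: "L-lipschitz_on S f"
    and u: "\<And>t. t \<in> closed_segment a b \<Longrightarrow> (u has_vector_derivative f (u t)) (at t) \<and> u t \<in> S"
    and v: "\<And>t. t \<in> closed_segment a b \<Longrightarrow> (v has_vector_derivative f (v t)) (at t) \<and> v t \<in> S"
  shows "norm (u b - v b) \<le> exp (L * \<bar>b - a\<bar>) * norm (u a - v a)"
proof (rule gronwall[where z' = "\<lambda>t. f (u t) - f (v t)"])
  fix t assume t: "t \<in> closed_segment a b"
  show "((\<lambda>t. u t - v t) has_vector_derivative f (u t) - f (v t)) (at t)"
    using u[OF t] v[OF t] by (intro has_vector_derivative_diff) auto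
  show "norm (f (u t) - f (v t)) \<le> L * norm (u t - v t)"
    using lipschitz_onD[OF lip] u[OF t] v[OF t] by (simp add: dist_norm)
qed

section \<open>Local existence and uniqueness of solutions\<close>

text \<open>The solution is the fixed point of \<open>w \<mapsto> (t \<mapsto> y + \<integral>\<^sub>0\<^sup>t g (w s) ds)\<close>. To have a complete metric
  space at hand, curves on \<open>{-d..d}\<close> are extended to bounded continuous functions on the line, constant
  outside the interval. The integral from \<open>0\<close> to \<open>t\<close> is written as a difference of two integrals
  starting at \<open>-d\<close>, so that \<open>t\<close> may be negative; estimating these separately, over lengths of at most
  \<open>2 d\<close> and \<open>d\<close>, gives the contraction constant \<open>3 d L\<close>.\<close>

lemma picard_global:
  fixes g :: "'a::euclidean_space \<Rightarrow> 'a"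
  assumes lip: "L-lipschitz_on UNIV g" and d: "d > 0" "3 * d * L < 1"
  obtains v where "v 0 = y" "\<And>t. t \<in> {-d<..<d} \<Longrightarrow> (v has_vector_derivative g (v t)) (at t)"
proof -
  have L: "L \<ge> 0" using lip by (rule lipschitz_on_nonneg)
  have cg: "continuous_on A (\<lambda>t. g (apply_bcontfun w t))" for A and w :: "real \<Rightarrow>\<^sub>C 'a"
    by (rule continuous_on_compose2[OF lipschitz_on_continuous_on[OF lip]]) auto
  have ig: "(\<lambda>t. g (apply_bcontfun w t)) integrable_on {a..b}" for a b and w :: "real \<Rightarrow>\<^sub>C 'a"
    by (rule integrable_continuous_real[OF cg])
  define P where "P w t = y + (integral {-d..t} (\<lambda>s. g (apply_bcontfun w s))
      - integral {-d..0} (\<lambda>s. g (apply_bcontfun w s)))" for w :: "real \<Rightarrow>\<^sub>C 'a" and t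
  have "\<exists>w'. (\<forall>t\<in>{-d..d}. apply_bcontfun w' t = P w t) \<and> (\<forall>t. apply_bcontfun w' t = P w (clamp (-d) d t))"
    for w :: "real \<Rightarrow>\<^sub>C 'a"
  proof -
    have "continuous_on (cbox (-d) d) (P w)"
      unfolding P_def cbox_interval by (intro continuous_intros indefinite_integral_continuous_1 ig)
    from continuous_on_cbox_bcontfunE[OF this] obtain w' :: "real \<Rightarrow>\<^sub>C 'a"
      where "\<And>t. t \<in> cbox (-d) d \<Longrightarrow> apply_bcontfun w' t = P w t"
        "\<And>t. apply_bcontfun w' t = P w (clamp (-d) d t)" by blast
    then show ?thesis unfolding cbox_interval by blast
  qed
  then obtain T where T: "\<And>w t. t \<in> {-d..d} \<Longrightarrow> apply_bcontfun (T w) t = P w t"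
    and Tc: "\<And>w t. apply_bcontfun (T w) t = P w (clamp (-d) d t)"
    by metis
  have "\<exists>!w. T w = w"
  proof (rule banach_fix_type[where c = "3 * d * L"])
    show "\<forall>w1 w2. dist (T w1) (T w2) \<le> 3 * d * L * dist w1 w2"
    proof (intro allI dist_bound)
      fix w1 w2 :: "real \<Rightarrow>\<^sub>C 'a" and x
      let ?h = "\<lambda>s. g (apply_bcontfun w1 s) - g (apply_bcontfun w2 s)"
      have B: "norm (integral {-d..t} ?h) \<le> L * dist w1 w2 * (t + d)" if "t \<ge> -d" for t
      proof -
        have bound: "norm (?h s) \<le> L * dist w1 w2" for s
        proof -
          have "norm (?h s) \<le> L * dist (apply_bcontfun w1 s) (apply_bcontfun w2 s)"
            using lipschitz_onD[OF lip, of "apply_bcontfun w1 s" "apply_bcontfun w2 s"]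
            by (simp add: dist_norm)
          also have "\<dots> \<le> L * dist w1 w2"
            by (intro mult_left_mono dist_bounded L)
          finally show ?thesis .
        qed
        have "norm (integral {-d..t} ?h) \<le> L * dist w1 w2 * (t - (- d))"
          by (rule integral_bound[OF that continuous_on_diff[OF cg[of "{-d..t}" w1] cg[of "{-d..t}" w2]]])
             (rule bound)
        then show ?thesis by simp
      qed
      define t where "t = clamp (-d) d x"
      have t: "t \<in> {-d..d}"
        using clamp_in_interval[of "-d" d x] d unfolding t_def cbox_interval by simp
      have "apply_bcontfun (T w1) x - apply_bcontfun (T w2) x
          = integral {-d..t} ?h - integral {-d..0} ?h"
        by (simp add: Tc P_def t_def[symmetric] integral_diff[OF ig ig])
      also have "norm \<dots> \<le> L * dist w1 w2 * (t + d) + L * dist w1 w2 * (0 + d)"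
        using order_trans[OF norm_triangle_ineq4 add_mono[OF B[of t] B[of 0]]] t d by simp
      also have "\<dots> = L * dist w1 w2 * (t + 2 * d)" by (simp add: algebra_simps)
      also have "\<dots> \<le> L * dist w1 w2 * (3 * d)"
        using t L by (intro mult_left_mono) auto
      finally show "dist (apply_bcontfun (T w1) x) (apply_bcontfun (T w2) x) \<le> 3 * d * L * dist w1 w2"
        by (simp add: dist_norm algebra_simps)
    qed
  qed (use d L in auto)
  then obtain w where w: "T w = w" by blast
  have wP: "apply_bcontfun w t = P w t" if "t \<in> {-d..d}" for t
    using T[OF that, of w] w by simp
  have "apply_bcontfun w 0 = y"
    using wP[of 0] d by (simp add: P_def)
  moreover have "(apply_bcontfun w has_vector_derivative g (apply_bcontfun w t)) (at t)"
    if t: "t \<in> {-d<..<d}" for t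
  proof -
    have "t \<in> {-d..d}" using t by simp
    from has_vector_derivative_add[OF has_vector_derivative_const[of y]
        has_vector_derivative_diff[OF integral_has_vector_derivative[OF cg[of _ w] this]
          has_vector_derivative_const[of "integral {-d..0} (\<lambda>s. g (apply_bcontfun w s))"]]]
    have "(P w has_vector_derivative g (apply_bcontfun w t)) (at t within {-d..d})"
      by (simp add: P_def[abs_def])
    then have "(P w has_vector_derivative g (apply_bcontfun w t)) (at t within {-d<..<d})"
      by (rule has_vector_derivative_within_subset) auto
    then have "(P w has_vector_derivative g (apply_bcontfun w t)) (at t)"
      using at_within_open[OF t] by simp
    then show ?thesis
      by (rule has_vector_derivative_transform_within_open[of _ _ _ "{-d<..<d}"])
         (use t wP in auto)
  qed
  ultimately show thesis by (rule that)
qed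

text \<open>Composing \<open>f\<close> with the nearest-point projection onto the ball, which is 1-Lipschitz, gives a
  globally Lipschitz and bounded field that agrees with \<open>f\<close> on the ball. Its solutions have speed at
  most \<open>M\<close>, so those starting in the smaller ball remain in the larger one for a time depending
  only on \<open>M\<close>, and until then they solve the original equation.\<close>

lemma local_existence:
  fixes f :: "'a::euclidean_space \<Rightarrow> 'a"
  assumes lip: "L-lipschitz_on (cball p 1) f"
  obtains d where "d > 0"
    "\<And>y. y \<in> cball p (1/2) \<Longrightarrow>
       \<exists>v. is_solution f y {-d<..<d} v \<and> (\<forall>t\<in>{-d<..<d}. v t \<in> cball p 1)"
proof -
  have L: "L \<ge> 0" using lip by (rule lipschitz_on_nonneg)
  \<comment> \<open>\<open>norm (f p) + L\<close> bounds the field on the unit ball; the summand 1 makes \<open>M\<close> positive and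
    larger than \<open>L\<close>, so that the same \<open>d\<close> also makes the Picard operator a contraction.\<close>
  define M where "M = norm (f p) + L + 1"
  define d where "d = 1 / (4 * M)"
  have M: "M > 0" "L < M" using L by (auto simp: M_def intro: add_nonneg_pos add_pos_nonneg)
  have d: "d > 0" "3 * d * L < 1" "M * d = 1/4"
    using M L by (auto simp: d_def field_simps)
  let ?c = "closest_point (cball p 1)"
  define g where "g = f \<circ> ?c"
  have c: "?c x \<in> cball p 1" for x
    by (rule closest_point_in_set) auto
  have lipg: "L-lipschitz_on UNIV g"
  proof (rule lipschitz_onI)
    fix x y
    have "dist (g x) (g y) \<le> L * dist (?c x) (?c y)"
      using lipschitz_onD[OF lip c c] by (simp add: g_def)
    also have "\<dots> \<le> L * dist x y"
      by (intro mult_left_mono closest_point_lipschitz L) auto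
    finally show "dist (g x) (g y) \<le> L * dist x y" .
  qed (rule L)
  have gM: "norm (g x) \<le> M" for x
  proof -
    have "dist (f (?c x)) (f p) \<le> L * dist (?c x) p"
      by (rule lipschitz_onD[OF lip c]) auto
    also have "\<dots> \<le> L * 1"
      using c[of x] L by (intro mult_left_mono) (auto simp: dist_commute)
    finally have "norm (f (?c x) - f p) \<le> L" by (simp add: dist_norm)
    then show ?thesis
      using norm_triangle_ineq2[of "f (?c x)" "f p"] by (simp add: g_def M_def)
  qed
  have "\<exists>v. is_solution f y {-d<..<d} v \<and> (\<forall>t\<in>{-d<..<d}. v t \<in> cball p 1)"
    if y: "y \<in> cball p (1/2)" for y
  proof -
    obtain v where v: "v 0 = y" "\<And>t. t \<in> {-d<..<d} \<Longrightarrow> (v has_vector_derivative g (v t)) (at t)"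
      using picard_global[OF lipg d(1,2)] by blast
    have inball: "v t \<in> cball p 1" if t: "t \<in> {-d<..<d}" for t
    proof -
      have "norm (v t - v 0) \<le> M * norm (t - 0)"
      proof (rule differentiable_bound[where S = "{-d<..<d}" and f' = "\<lambda>s h. h *\<^sub>R g (v s)"])
        fix s assume s: "s \<in> {-d<..<d}"
        show "(v has_derivative (\<lambda>h. h *\<^sub>R g (v s))) (at s within {-d<..<d})"
          using v(2)[OF s] by (auto simp: has_vector_derivative_def intro: has_derivative_at_withinI)
        show "onorm (\<lambda>h. h *\<^sub>R g (v s)) \<le> M"
        proof (rule onorm_bound)
          show "norm (h *\<^sub>R g (v s)) \<le> M * norm h" for h
            using mult_right_mono[OF gM[of "v s"], of "\<bar>h\<bar>"] by (simp add: mult.commute)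
        qed (use M in simp)
      qed (use t d in auto)
      also have "\<dots> \<le> M * d" using t M by (intro mult_left_mono) auto
      finally have "dist (v t) y \<le> 1/4" using d v by (simp add: dist_norm)
      then show ?thesis
        using y dist_triangle[of p "v t" y] by (simp add: dist_commute)
    qed
    have "g (v t) = f (v t)" if "t \<in> {-d<..<d}" for t
      using closest_point_self[OF inball[OF that]] by (simp add: g_def)
    then have "is_solution f y {-d<..<d} v"
      using v d by (auto simp: is_solution_def is_interval_convex_1)
    then show ?thesis using inball by blast
  qed
  then show thesis using that d by blast
qed

lemma solution_continuous: "is_solution f x J u \<Longrightarrow> t \<in> J \<Longrightarrow> isCont u t"
  unfolding is_solution_def by (blast intro: has_vector_derivative_continuous)

lemma solution_stays_near:
  assumes "is_solution f x J u" "t0 \<in> J" "e > 0"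
  obtains d where "d > 0" "\<And>t. \<bar>t - t0\<bar> < d \<Longrightarrow> t \<in> J \<and> dist (u t) (u t0) < e"
proof -
  have "eventually (\<lambda>t. t \<in> J) (at t0)"
    using assms by (intro eventually_at_in_open') (auto simp: is_solution_def)
  moreover have "eventually (\<lambda>t. dist (u t) (u t0) < e) (at t0)"
    using solution_continuous[OF assms(1,2)] assms(3) by (auto simp: isCont_def intro: tendstoD)
  ultimately have "eventually (\<lambda>t. t \<in> J \<and> dist (u t) (u t0) < e) (at t0)"
    by eventually_elim auto
  then obtain d where "d > 0" "\<And>t. t \<noteq> t0 \<Longrightarrow> dist t t0 < d \<Longrightarrow> t \<in> J \<and> dist (u t) (u t0) < e"
    by (auto simp: eventually_at)
  then show thesis
    using assms by (intro that[of d]) (metis dist_real_def dist_self)+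
qed

lemma open_closed_propagation:
  fixes K :: "real set"
  assumes "connected K" "t0 \<in> K" "P t0" "t \<in> K"
    and "open": "\<And>t. t \<in> K \<Longrightarrow> P t \<Longrightarrow> \<exists>d>0. \<forall>s. \<bar>s - t\<bar> < d \<longrightarrow> P s"
    and closed: "closedin (top_of_set K) {t \<in> K. P t}"
  shows "P t"
proof -
  have "openin (top_of_set K) {t \<in> K. P t}"
    unfolding openin_euclidean_subtopology_iff dist_real_def using "open" by fastforce
  then have "{t \<in> K. P t} = {} \<or> {t \<in> K. P t} = K"
    using \<open>connected K\<close> closed by (auto simp: connected_clopen)
  then show ?thesis using assms(2-4) by blast
qed

text \<open>Two solutions that agree at some time agree nearby, by the exponential bound with initial distance
  zero. The ball in which \<open>f\<close> is Lipschitz is centred at the common value at that time, hence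
  the propagation along the common time interval.\<close>

lemma solution_unique:
  fixes f :: "'a::euclidean_space \<Rightarrow> 'a"
  assumes lip: "\<And>p. \<exists>L. L-lipschitz_on (cball p 1) f"
    and u: "is_solution f x I u" and v: "is_solution f x J v" and t: "t \<in> I" "t \<in> J"
  shows "u t = v t"
proof (rule open_closed_propagation[where K = "I \<inter> J" and ?t0.0 = 0])
  show "connected (I \<inter> J)" "0 \<in> I \<inter> J" "u 0 = v 0" "t \<in> I \<inter> J"
    using u v t by (auto simp: is_solution_def is_interval_connected_1[symmetric] is_interval_Int)
  have "continuous_on (I \<inter> J) (\<lambda>t. u t - v t)"
    using u v by (intro continuous_on_diff continuous_at_imp_continuous_on)
      (auto intro: solution_continuous)
  from continuous_closedin_preimage_constant[OF this, of 0]
  show "closedin (top_of_set (I \<inter> J)) {t \<in> I \<inter> J. u t = v t}" by simp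
next
  fix t0 assume t0: "t0 \<in> I \<inter> J" and eq: "u t0 = v t0"
  obtain L where L: "L-lipschitz_on (cball (u t0) 1) f" using lip by blast
  obtain d1 where d1: "d1 > 0" "\<And>t. \<bar>t - t0\<bar> < d1 \<Longrightarrow> t \<in> I \<and> dist (u t) (u t0) < 1"
    using solution_stays_near[OF u, of t0 1] t0 by auto
  obtain d2 where d2: "d2 > 0" "\<And>t. \<bar>t - t0\<bar> < d2 \<Longrightarrow> t \<in> J \<and> dist (v t) (v t0) < 1"
    using solution_stays_near[OF v, of t0 1] t0 by auto
  have "u s = v s" if s: "\<bar>s - t0\<bar> < min d1 d2" for s
  proof -
    have near: "\<bar>t - t0\<bar> < d1" "\<bar>t - t0\<bar> < d2" if "t \<in> closed_segment t0 s" for t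
      using that s by (auto simp: closed_segment_eq_real_ivl split: if_splits)
    have "norm (u s - v s) \<le> exp (L * \<bar>s - t0\<bar>) * norm (u t0 - v t0)"
    proof (rule solutions_diverge_at_most_exponentially[OF L])
      fix t assume t: "t \<in> closed_segment t0 s"
      show "(u has_vector_derivative f (u t)) (at t) \<and> u t \<in> cball (u t0) 1"
        using d1(2)[OF near(1)[OF t]] u by (auto simp: is_solution_def dist_commute)
      show "(v has_vector_derivative f (v t)) (at t) \<and> v t \<in> cball (u t0) 1"
        using d2(2)[OF near(2)[OF t]] v eq by (auto simp: is_solution_def dist_commute)
    qed
    then show ?thesis using eq by simp
  qed
  then show "\<exists>d>0. \<forall>s. \<bar>s - t0\<bar> < d \<longrightarrow> u s = v s"
    using d1(1) d2(1) by (intro exI[of _ "min d1 d2"]) auto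
qed

lemma flow_eq_solution:
  fixes f :: "'a::euclidean_space \<Rightarrow> 'a"
  assumes lip: "\<And>p. \<exists>L. L-lipschitz_on (cball p 1) f"
    and u: "is_solution f x J u" "t \<in> J"
  shows "flow f t x = u t"
  unfolding flow_def
proof (rule the_equality)
  show "\<exists>J' u'. is_solution f x J' u' \<and> t \<in> J' \<and> u' t = u t" using u by blast
  show "y = u t" if "\<exists>J' u'. is_solution f x J' u' \<and> t \<in> J' \<and> u' t = y" for y
    using that solution_unique[OF lip _ u(1) _ u(2)] by blast
qed

section \<open>Critical points of a conserved quantity\<close>

text \<open>This is where differentiability of the flow is bypassed: for \<open>G\<close> to inherit a vanishing
  derivative, it is enough that going back from time \<open>s\<close> to \<open>t0\<close> increases distances to the given
  solution by at most a constant factor \<open>C\<close>. The uniform time of existence ensures that every point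
  near \<open>u s\<close> can be taken back this far.\<close>

lemma critical_point_carried_locally:
  fixes f :: "'a::euclidean_space \<Rightarrow> 'a" and G :: "'a \<Rightarrow> 'b::real_normed_vector"
  assumes lip: "L-lipschitz_on (cball (u t0) 1) f"
    and cons: "\<And>y I v t. is_solution f y I v \<Longrightarrow> t \<in> I \<Longrightarrow> G (v t) = G y"
    and u: "is_solution f x J u" and t0: "t0 \<in> J"
    and crit: "(G has_derivative (\<lambda>_. 0)) (at (u t0))"
  shows "\<exists>d>0. \<forall>s. \<bar>s - t0\<bar> < d \<longrightarrow> (G has_derivative (\<lambda>_. 0)) (at (u s))"
proof -
  define p where "p = u t0"
  obtain \<delta> where \<delta>: "\<delta> > 0" "\<And>y. y \<in> cball p (1/2) \<Longrightarrow>
       \<exists>v. is_solution f y {-\<delta><..<\<delta>} v \<and> (\<forall>t\<in>{-\<delta><..<\<delta>}. v t \<in> cball p 1)"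
    using local_existence[OF lip] unfolding p_def by blast
  obtain \<epsilon> where \<epsilon>: "\<epsilon> > 0" "\<And>t. \<bar>t - t0\<bar> < \<epsilon> \<Longrightarrow> t \<in> J \<and> dist (u t) p < 1/4"
    using solution_stays_near[OF u t0, of "1/4"] unfolding p_def by auto
  have "(G has_derivative (\<lambda>_. 0)) (at (u s))" if s: "\<bar>s - t0\<bar> < min \<delta> \<epsilon>" for s
    unfolding has_derivative_at_alt
  proof (intro conjI allI impI)
    fix e :: real assume "e > 0"
    \<comment> \<open>The Lipschitz constant of the flow from time \<open>s\<close> to time \<open>t0\<close>; tolerance \<open>e / C\<close> at \<open>p\<close>
      becomes tolerance \<open>e\<close> at \<open>u s\<close>.\<close>
    define C where "C = exp (L * \<bar>t0 - s\<bar>)"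
    have C: "C > 0" by (simp add: C_def)
    obtain r where r: "r > 0" "\<And>y. norm (y - p) < r \<Longrightarrow> norm (G y - G p) \<le> e / C * norm (y - p)"
      using crit \<open>e > 0\<close> C unfolding has_derivative_at_alt p_def
      by (auto dest!: spec[of _ "e / C"])
    have "norm (G y - G (u s)) \<le> e * norm (y - u s)" if y: "norm (y - u s) < min (r / C) (1/4)" for y
    proof -
      have "dist p y \<le> dist p (u s) + dist (u s) y" by (rule dist_triangle)
      then have "y \<in> cball p (1/2)"
        using \<epsilon>(2)[of s] s y by (auto simp: dist_norm norm_minus_commute)
      then obtain v where v: "is_solution f y {-\<delta><..<\<delta>} v"
          "\<And>t. t \<in> {-\<delta><..<\<delta>} \<Longrightarrow> v t \<in> cball p 1"
        using \<delta>(2) by blast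
      \<comment> \<open>Solutions are normalised to start at time 0, so the given one is shifted by \<open>s\<close> and both
        are followed from time 0 to time \<open>b\<close>.\<close>
      define b where "b = t0 - s"
      have "norm (v b - u (s + b)) \<le> exp (L * \<bar>b - 0\<bar>) * norm (v 0 - u (s + 0))"
      proof (rule solutions_diverge_at_most_exponentially[OF lip, folded p_def])
        fix t assume t: "t \<in> closed_segment 0 b"
        then have t1: "t \<in> {-\<delta><..<\<delta>}" and t2: "\<bar>(s + t) - t0\<bar> < \<epsilon>"
          using s by (auto simp: closed_segment_eq_real_ivl b_def split: if_splits)
        show "(v has_vector_derivative f (v t)) (at t) \<and> v t \<in> cball p 1"
          using v t1 by (auto simp: is_solution_def)
        have "((+) s has_vector_derivative 1) (at t)"
          by (auto intro!: derivative_eq_intros)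
        moreover have "(u has_vector_derivative f (u (s + t))) (at (s + t))"
          using u \<epsilon>(2)[OF t2] by (auto simp: is_solution_def)
        ultimately have "((u \<circ> (+) s) has_vector_derivative 1 *\<^sub>R f (u (s + t))) (at t)"
          by (rule vector_diff_chain_at)
        then show "((\<lambda>t. u (s + t)) has_vector_derivative f (u (s + t))) (at t) \<and> u (s + t) \<in> cball p 1"
          using \<epsilon>(2)[OF t2] by (auto simp: o_def dist_commute)
      qed
      then have close: "norm (v b - p) \<le> C * norm (y - u s)"
        using v(1) by (simp add: b_def C_def p_def is_solution_def)
      also have "\<dots> < r"
        using y C by (simp add: field_simps)
      finally have "norm (G (v b) - G p) \<le> e / C * norm (v b - p)" by (rule r(2))
      also have "\<dots> \<le> e / C * (C * norm (y - u s))"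
        using close C \<open>e > 0\<close> by (intro mult_left_mono) auto
      also have "\<dots> = e * norm (y - u s)" using C by simp
      finally have "norm (G (v b) - G p) \<le> e * norm (y - u s)" .
      moreover have "G (v b) = G y"
        using s by (intro cons[OF v(1)]) (auto simp: b_def)
      moreover have "G p = G (u s)"
        using cons[OF u] \<epsilon>(2)[of s] s t0 by (simp add: p_def)
      ultimately show ?thesis by simp
    qed
    then show "\<exists>d>0. \<forall>y. norm (y - u s) < d \<longrightarrow> norm (G y - G (u s) - 0) \<le> e * norm (y - u s)"
      using r(1) C by (intro exI[of _ "min (r / C) (1/4)"]) auto
  qed simp
  then show ?thesis
    using \<delta>(1) \<epsilon>(1) by (intro exI[of _ "min \<delta> \<epsilon>"]) auto
qed

text \<open>Continuity of \<open>D\<close> makes the set of critical times closed, which turns the local statement into one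
  about the whole interval.\<close>

lemma critical_point_carried:
  fixes f :: "'a::euclidean_space \<Rightarrow> 'a" and G :: "'a \<Rightarrow> 'b::real_normed_vector"
  assumes lip: "\<And>p. \<exists>L. L-lipschitz_on (cball p 1) f"
    and der: "\<And>x. (G has_derivative D x) (at x)"
    and cont: "\<And>v. continuous_on UNIV (\<lambda>x. D x v)"
    and cons: "\<And>y I v t. is_solution f y I v \<Longrightarrow> t \<in> I \<Longrightarrow> G (v t) = G y"
    and u: "is_solution f x J u" and s: "s \<in> J" "t \<in> J"
    and crit: "\<forall>v. D (u s) v = 0"
  shows "\<forall>v. D (u t) v = 0"
proof (rule open_closed_propagation[where K = J and ?t0.0 = s])
  show "connected J"
    using u by (simp add: is_solution_def is_interval_connected_1)
  have "closedin (top_of_set J) (\<Inter>v. {t \<in> J. D (u t) v = 0})"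
  proof (intro closedin_INT continuous_closedin_preimage_constant)
    fix v show "continuous_on J (\<lambda>t. D (u t) v)"
      by (rule continuous_on_compose2[OF cont])
         (use solution_continuous[OF u] in \<open>auto intro: continuous_at_imp_continuous_on\<close>)
  qed auto
  also have "(\<Inter>v. {t \<in> J. D (u t) v = 0}) = {t \<in> J. \<forall>v. D (u t) v = 0}" by auto
  finally show "closedin (top_of_set J) {t \<in> J. \<forall>v. D (u t) v = 0}" .
next
  have iff: "(\<forall>v. D y v = 0) \<longleftrightarrow> (G has_derivative (\<lambda>_. 0)) (at y)" for y
    using der[of y] has_derivative_unique[OF der[of y]] by (metis ext)
  fix t0 assume t0: "t0 \<in> J" "\<forall>v. D (u t0) v = 0"
  obtain L where L: "L-lipschitz_on (cball (u t0) 1) f" using lip by blast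
  show "\<exists>d>0. \<forall>s. \<bar>s - t0\<bar> < d \<longrightarrow> (\<forall>v. D (u s) v = 0)"
    unfolding iff
    by (rule critical_point_carried_locally[where f = f and G = G and u = u, OF L _ u t0(1)])
       (use cons t0(2) iff in blast)+
qed (use s crit in auto)

section \<open>Invariance of the rank\<close>

text \<open>The left kernel is the orthogonal complement of the range, and in finite dimension a subspace
  is the complement of its complement.\<close>

lemma rank_eq_if_same_left_kernel:
  fixes A B :: "real^'n^'k"
  assumes "\<And>w. (\<forall>v. w \<bullet> (A *v v) = 0) \<longleftrightarrow> (\<forall>v. w \<bullet> (B *v v) = 0)"
  shows "rank A = rank B"
proof -
  have "(range ((*v) A))\<^sup>\<bottom> = (range ((*v) B))\<^sup>\<bottom>"
    using assms by (auto simp: orthogonal_comp_def orthogonal_def inner_commute)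
  moreover have "subspace (range ((*v) M))" for M :: "real^'n^'k"
    by (intro linear_subspace_image matrix_vector_mul_linear subspace_UNIV)
  ultimately have "range ((*v) A) = range ((*v) B)"
    by (metis orthogonal_comp_self)
  then show ?thesis by (simp add: rank_dim_range)
qed

theorem theorem2p3:
  fixes f :: "real^'n \<Rightarrow> real^'n" and F :: "real^'n \<Rightarrow> real^'k" and q :: nat
  assumes "q \<ge> 1"
    and "CARD('k) \<le> CARD('n)"
    and "C_diff q f"
    and "C_diff q F"
    and "conserved_quantity f F"
  shows "\<forall>s\<in>{0..CARD('k)}. invariant_set f (rank_set F s)"
proof -
  have lip: "\<exists>L. L-lipschitz_on (cball p 1) f" for p
    using C_diff_imp_locally_lipschitz[OF assms(3,1)] by blast
  have cons: "F (v t) = F y" if "is_solution f y I v" "t \<in> I" for y I v t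
    using assms(5) that flow_eq_solution[OF lip that]
    by (force simp: conserved_quantity_def flow_dom_def)
  let ?D = "\<lambda>x. frechet_derivative F (at x)"
  have diff: "F differentiable (at x)" for x
    by (rule C_diff_imp_differentiable[OF assms(4,1)])
  have jac: "jacobian F (at x) *v h = ?D x h" for x h
    using diff jacobian_works frechet_derivative_at by metis
  have rank: "rank (jacobian F (at (u t))) = rank (jacobian F (at x))"
    if u: "is_solution f x J u" and t: "t \<in> J" for x J u t
  proof (rule rank_eq_if_same_left_kernel)
    fix w
    \<comment> \<open>Stated for arbitrary two times: from 0 to \<open>t\<close> it gives one inclusion of the left kernels,
      from \<open>t\<close> to 0 the other.\<close>
    have carried: "\<forall>h. w \<bullet> ?D (u b) h = 0"
      if "\<forall>h. w \<bullet> ?D (u a) h = 0" "a \<in> J" "b \<in> J" for a b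
    proof (rule critical_point_carried[where f = f and G = "\<lambda>x. w \<bullet> F x"
          and D = "\<lambda>x h. w \<bullet> ?D x h" and u = u and s = a and J = J, OF lip])
      show "((\<lambda>x. w \<bullet> F x) has_derivative (\<lambda>h. w \<bullet> ?D x h)) (at x)" for x
        using diff[of x] by (intro has_derivative_inner_right) (simp add: frechet_derivative_works)
      show "continuous_on UNIV (\<lambda>x. w \<bullet> ?D x h)" for h
        by (intro continuous_intros C_diff_imp_continuous_derivative[OF assms(4,1)])
      show "w \<bullet> F (v t) = w \<bullet> F y" if "is_solution f y I v" "t \<in> I" for y I v t
        using cons[OF that] by simp
      show "is_solution f x J u" by (rule u)
    qed (rule that)+
    have "0 \<in> J" and u0: "u 0 = x" using u by (auto simp: is_solution_def)
    then show "(\<forall>h. w \<bullet> (jacobian F (at (u t)) *v h) = 0) \<longleftrightarrow> (\<forall>h. w \<bullet> (jacobian F (at x) *v h) = 0)"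
      using carried[of 0 t] carried[of t 0] t unfolding jac u0 by blast
  qed
  show ?thesis
    unfolding invariant_set_def
  proof (intro ballI)
    fix s x t assume "x \<in> rank_set F s" "t \<in> flow_dom f x"
    then obtain J u where u: "is_solution f x J u" "t \<in> J" by (auto simp: flow_dom_def)
    then show "flow f t x \<in> rank_set F s"
      using \<open>x \<in> rank_set F s\<close> rank[OF u] flow_eq_solution[OF lip u] by (simp add: rank_set_def)
  qed
qed

end
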